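(* Let $(X,T)$ be a topological dynamical system with metric $d$ and let $\mu$ be a Borel probability measure on $X$ (not necessarily $T$-invariant). Consider the following properties: 1) $(X,T)$ is $\mu$-equicontinuous. 2) $\mu$-almost every $x\in X$ is a $\mu$-equicontinuity point of $(X,T)$. 3) There exists $X'\subset X$ such that $\mu(X')=1$ and $(X',d_o)$ is separable, where $d_o$ is the orbit metric. Then: 1) holds if and only if 3) holds. If $(X,\mu)$ is Vitali, then 2) implies 1). If $(X,\mu)$ satisfies Lebesgue's density theorem, then 1) implies 2).
   Context: $\mathbb{N}=\{1,2,\dots\}$. A topological dynamical system (TDS) is a pair $(X,T)$ where $X$ is a compact metric space with metric $d$ and $T:X\to X$ is continuous. For $x\in X$ and $n\in\mathbb{N}$, $B_n(x)=\{z\in X: d(x,z)\le 1/n\}$. The orbit metric is $d_o(x,y)=\sup_{i\ge 0} d(T^ix,T^iy)$, and the orbit balls are $B^o_m(x)=\{y\in X: d_o(x,y)\le 1/m\}$. For $M\subset X$, $T|_M$ is called equicontinuous if for all $x\in M$ and $m\in\mathbb{N}$ there exists $n\in\mathbb{N}$ such that $B_n(x)\cap M\subset B^o_m(x)$. $(X,T)$ is $\mu$-equicontinuous if for every $\varepsilon>0$ there exists a compact set $M\subset X$ such that $\mu(M)>1-\varepsilon$ and $T|_M$ is equicontinuous. A point $x$ is a $\mu$-equicontinuity point of $(X,T)$ if for all $m\in\mathbb{N}$, $\lim_{n\to\infty}\frac{\mu(B^o_m(x)\cap B_n(x))}{\mu(B_n(x))}=1$ (in particular $\mu(B_n(x))>0$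 for all $n$). $(X,\mu)$ satisfies Lebesgue's density theorem if for every Borel set $A\subset X$, $\lim_{n\to\infty}\frac{\mu(A\cap B_n(x))}{\mu(B_n(x))}=1$ for $\mu$-a.e. $x\in A$. $(X,\mu)$ is Vitali if for every Borel set $A\subset X$, every $N\in\mathbb{N}$ and every $\varepsilon>0$, there exist a finite subset $F\subset A$ and integers $n_x\ge N$ (for $x\in F$) such that the balls $\{B_{n_x}(x)\}_{x\in F}$ are pairwise disjoint and $\mu(A\setminus\bigcup_{x\in F}B_{n_x}(x))\le\varepsilon$. *)

theory Defs
  imports "HOL-Probability.Probability"
begin

text \<open>
  The phase space is a whole type of class \<open>metric_space\<close>, assumed compact through
  \<open>compact UNIV\<close>. Then \<open>B_n(x)\<close> is \<open>cball x (1 / real n)\<close>. Indices into balls range over the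
  positive integers.
\<close>

definition orbit_dist :: "('a::metric_space \<Rightarrow> 'a) \<Rightarrow> 'a \<Rightarrow> 'a \<Rightarrow> real" where
  "orbit_dist T x y = (SUP i. dist ((T ^^ i) x) ((T ^^ i) y))"

definition orbit_ball :: "('a::metric_space \<Rightarrow> 'a) \<Rightarrow> nat \<Rightarrow> 'a \<Rightarrow> 'a set" where
  "orbit_ball T m x = {y. orbit_dist T x y \<le> 1 / real m}"

definition equicontinuous_on_set :: "('a::metric_space \<Rightarrow> 'a) \<Rightarrow> 'a set \<Rightarrow> bool" where
  "equicontinuous_on_set T M \<longleftrightarrow>
     (\<forall>x\<in>M. \<forall>m\<ge>1. \<exists>n::nat\<ge>1. cball x (1 / real n) \<inter> M \<subseteq> orbit_ball T m x)"

definition mu_equicontinuous :: "'a::metric_space measure \<Rightarrow> ('a \<Rightarrow> 'a) \<Rightarrow> bool" where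
  "mu_equicontinuous \<mu> T \<longleftrightarrow>
     (\<forall>\<epsilon>>0. \<exists>M. compact M \<and> measure \<mu> M > 1 - \<epsilon> \<and> equicontinuous_on_set T M)"

text \<open>
  Since \<open>a / 0 = 0\<close>, the limit being \<open>1\<close> in the next definitions forces
  \<open>\<mu> (B_n(x)) > 0\<close> for all \<open>n\<close> (the balls are nested); cf. \<open>mu_equicontinuity_point_pos\<close>.
\<close>

definition mu_equicontinuity_point :: "'a::metric_space measure \<Rightarrow> ('a \<Rightarrow> 'a) \<Rightarrow> 'a \<Rightarrow> bool" where
  "mu_equicontinuity_point \<mu> T x \<longleftrightarrow>
     (\<forall>m\<ge>1. (\<lambda>n. measure \<mu> (orbit_ball T m x \<inter> cball x (1 / real n))
                   / measure \<mu> (cball x (1 / real n))) \<longlonglongrightarrow> 1)"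

definition lebesgue_density :: "'a::metric_space measure \<Rightarrow> bool" where
  "lebesgue_density \<mu> \<longleftrightarrow>
     (\<forall>A\<in>sets borel. AE x in \<mu>. x \<in> A \<longrightarrow>
        (\<lambda>n. measure \<mu> (A \<inter> cball x (1 / real n)) / measure \<mu> (cball x (1 / real n)))
          \<longlonglongrightarrow> 1)"

definition vitali :: "'a::metric_space measure \<Rightarrow> bool" where
  "vitali \<mu> \<longleftrightarrow>
     (\<forall>A\<in>sets borel. \<forall>N\<ge>1. \<forall>\<epsilon>>0. \<exists>F (n :: 'a \<Rightarrow> nat).
        finite F \<and> F \<subseteq> A \<and> (\<forall>x\<in>F. n x \<ge> N) \<and>
        disjoint_family_on (\<lambda>x. cball x (1 / real (n x))) F \<and>
        measure \<mu> (A - (\<Union>x\<in>F. cball x (1 / real (n x)))) \<le> \<epsilon>)"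

lemma orbit_dist_bdd_above:
  fixes T :: "'a::metric_space \<Rightarrow> 'a"
  assumes "compact (UNIV :: 'a set)"
  shows "bdd_above (range (\<lambda>i. dist ((T ^^ i) x) ((T ^^ i) y)))"
proof -
  obtain e where "dist u v \<le> e" for u v :: 'a
    using compact_imp_bounded[OF assms] unfolding bounded_two_points by blast
  then show ?thesis
    by (intro bdd_aboveI2)
qed

lemma Metric_space_orbit_dist:
  fixes T :: "'a::metric_space \<Rightarrow> 'a"
  assumes "compact (UNIV :: 'a set)"
  shows "Metric_space M (orbit_dist T)"
proof
  note bdd = orbit_dist_bdd_above[OF assms]
  have le: "dist ((T ^^ i) x) ((T ^^ i) y) \<le> orbit_dist T x y" for i x y
    unfolding orbit_dist_def by (intro cSUP_upper bdd UNIV_I)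
  fix x y z
  show nonneg: "0 \<le> orbit_dist T x y"
    using le[of 0 x y] zero_le_dist order_trans by (metis funpow_0)
  show "orbit_dist T x y = orbit_dist T y x"
    by (simp add: orbit_dist_def dist_commute)
  show "orbit_dist T x y = 0 \<longleftrightarrow> x = y"
  proof
    assume "orbit_dist T x y = 0"
    with le[of 0 x y] show "x = y" by simp
  qed (simp add: orbit_dist_def)
  show "orbit_dist T x z \<le> orbit_dist T x y + orbit_dist T y z"
    unfolding orbit_dist_def[of T x z]
  proof (rule cSUP_least)
    fix i
    show "dist ((T ^^ i) x) ((T ^^ i) z) \<le> orbit_dist T x y + orbit_dist T y z"
      using dist_triangle[of "(T ^^ i) x" "(T ^^ i) z" "(T ^^ i) y"] le[of i x y] le[of i y z]
      by linarith
  qed simp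
qed

lemma mu_equicontinuity_point_pos:
  assumes "prob_space \<mu>" "sets \<mu> = sets borel"
    and "mu_equicontinuity_point \<mu> T x" "n \<ge> 1"
  shows "measure \<mu> (cball x (1 / real n)) > 0"
proof (rule ccontr)
  interpret prob_space \<mu> by fact
  assume "\<not> measure \<mu> (cball x (1 / real n)) > 0"
  then have 0: "measure \<mu> (cball x (1 / real n)) = 0"
    by (simp add: zero_less_measure_iff)
  have "measure \<mu> (cball x (1 / real k)) = 0" if "k \<ge> n" for k
  proof -
    have "cball x (1 / real k) \<subseteq> cball x (1 / real n)"
      using that \<open>n \<ge> 1\<close> by (intro subset_cball) (simp add: frac_le)
    then have "measure \<mu> (cball x (1 / real k)) \<le> measure \<mu> (cball x (1 / real n))"
      by (intro finite_measure_mono) (simp_all add: assms(2))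
    then show ?thesis using 0 by (simp add: measure_le_0_iff)
  qed
  then have "eventually (\<lambda>k. measure \<mu> (orbit_ball T 1 x \<inter> cball x (1 / real k))
      / measure \<mu> (cball x (1 / real k)) = 0) sequentially"
    by (auto intro!: eventually_sequentiallyI[of n])
  then have "(\<lambda>k. measure \<mu> (orbit_ball T 1 x \<inter> cball x (1 / real k))
      / measure \<mu> (cball x (1 / real k))) \<longlonglongrightarrow> 0"
    by (rule tendsto_eventually)
  moreover have "(\<lambda>k. measure \<mu> (orbit_ball T 1 x \<inter> cball x (1 / real k))
      / measure \<mu> (cball x (1 / real k))) \<longlonglongrightarrow> 1"
    using assms(3) by (simp add: mu_equicontinuity_point_def)
  ultimately show False
    using LIMSEQ_unique zero_neq_one by blast
qed

end

theory Submission
  imports Defs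
begin

text \<open>
  Orbit balls are \<open>d\<close>-closed and hence compact, so \<open>\<mu>\<close>-equicontinuity follows once, at every
  scale, all but an \<open>\<epsilon>\<close> of the mass is covered by finitely many disjoint closed sets of small
  \<open>d\<^sub>o\<close>-diameter: intersect these coverings over all scales, and use that disjoint compact sets
  have positive distance. Under separability the closed sets come from a countable cover by
  orbit balls, each ball being cut back to positive distance from the preceding ones. Under the
  Vitali property they are the sets \<open>B\<^sup>o\<^sub>m(x) \<inter> B\<^sub>n(x)\<close> for the centres \<open>x\<close> of a Vitali family.
\<close>

section \<open>Semicontinuity of the measure of a set that moves with a parameter\<close>

text \<open>Superlevel sets are closed: when \<open>X k\<close> converges to \<open>x\<close>, the
  upper limit of the sets \<open>R (X k)\<close> lies in \<open>R x\<close>, and a finite measure is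
  continuous from above. This makes the measures of balls, and of their intersections with orbit
  balls, Borel functions of the centre.\<close>

lemma (in finite_measure) borel_measurable_measure_section:
  fixes R :: "'b::metric_space \<Rightarrow> 'a set"
  assumes R: "\<And>x. R x \<in> sets M" and closed: "\<And>y. closed {x. y \<in> R x}"
  shows "(\<lambda>x. measure M (R x)) \<in> borel_measurable borel"
proof -
  have "closed {x. a \<le> measure M (R x)}" for a
    unfolding closed_sequential_limits
  proof safe
    fix X x
    assume a: "\<forall>k. X k \<in> {x. a \<le> measure M (R x)}" and X: "X \<longlonglongrightarrow> x"
    define U where "U k = (\<Union>j\<in>{k..}. R (X j))" for k
    have U: "U k \<in> sets M" for k
      unfolding U_def using R by (intro sets.countable_UN') auto
    have "(\<lambda>k. measure M (U k)) \<longlonglongrightarrow> measure M (\<Inter>k. U k)"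
      using U by (intro finite_Lim_measure_decseq) (force simp: decseq_def U_def)+
    moreover have "a \<le> measure M (U k)" for k
    proof -
      have "measure M (R (X k)) \<le> measure M (U k)"
        using U by (intro finite_measure_mono) (auto simp: U_def)
      with a show ?thesis by (force intro: order_trans)
    qed
    ultimately have "a \<le> measure M (\<Inter>k. U k)"
      by (intro LIMSEQ_le_const) auto
    \<comment> \<open>A \<open>y\<close> in every \<open>U k\<close> belongs to
      \<open>R (X j)\<close> for arbitrarily large \<open>j\<close>, so closedness of
      \<open>{x. y \<in> R x}\<close> carries the membership over to the limit.\<close>
    also have "(\<Inter>k. U k) \<subseteq> R x"
    proof (rule subsetI, rule ccontr)
      fix y assume y: "y \<in> (\<Inter>k. U k)" and "y \<notin> R x"
      then have "eventually (\<lambda>k. X k \<in> - {x. y \<in> R x}) sequentially"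
        using closed[of y] by (intro topological_tendstoD[OF X]) auto
      with y show False
        by (auto simp: eventually_sequentially U_def)
    qed
    then have "measure M (\<Inter>k. U k) \<le> measure M (R x)"
      using R by (intro finite_measure_mono)
    finally show "a \<le> measure M (R x)" .
  qed
  then show ?thesis
    by (simp add: borel_measurable_iff_ge)
qed

section \<open>Orbit balls in the topology of \<open>dist\<close>\<close>

locale prob_tds = prob_space \<mu>
  for \<mu> :: "'a::metric_space measure" +
  fixes T :: "'a \<Rightarrow> 'a"
  assumes compact_UNIV: "compact (UNIV :: 'a set)"
    and continuous_T: "continuous_on UNIV T"
    and sets_eq: "sets \<mu> = sets borel"
begin

sublocale orbit: Metric_space UNIV "orbit_dist T"
  by (rule Metric_space_orbit_dist[OF compact_UNIV])

lemma space_eq [simp]: "space \<mu> = UNIV"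
  using sets_eq_imp_space_eq[OF sets_eq] by simp

lemma closed_in_sets [simp]: "closed A \<Longrightarrow> A \<in> sets \<mu>"
  by (simp add: sets_eq)

lemma orbit_dist_le_iff: "orbit_dist T x y \<le> c \<longleftrightarrow> (\<forall>i. dist ((T ^^ i) x) ((T ^^ i) y) \<le> c)"
  unfolding orbit_dist_def
  by (subst cSUP_le_iff) (auto intro: orbit_dist_bdd_above[OF compact_UNIV])

lemma continuous_funpow: "continuous_on UNIV (T ^^ i)"
proof (induction i)
  case (Suc i)
  then show ?case
    using continuous_on_compose[OF Suc continuous_on_subset[OF continuous_T]] by simp
qed (simp add: continuous_on_id')

lemma orbit_ball_eq: "orbit_ball T m x = (\<Inter>i. {y. dist ((T ^^ i) x) ((T ^^ i) y) \<le> 1 / real m})"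
  by (auto simp: orbit_ball_def orbit_dist_le_iff)

text \<open>The iterates of \<open>T\<close> are continuous, so every set in
  \<open>orbit_ball_eq\<close> is closed. Closedness for \<open>dist\<close>, and not only for the
  orbit metric, makes orbit balls Borel.\<close>

lemma closed_orbit_ball: "closed (orbit_ball T m x)"
  unfolding orbit_ball_eq
  by (intro closed_INT ballI closed_Collect_le continuous_intros continuous_funpow)

lemma orbit_ball_commute: "y \<in> orbit_ball T m x \<longleftrightarrow> x \<in> orbit_ball T m y"
  by (simp add: orbit_ball_def orbit.commute)

text \<open>Equicontinuity compares points of \<open>M\<close> with each other, whereas the covering
  sets lie in orbit balls about unrelated centres. Halving the radius allows recentring at any point
  of the ball.\<close>

lemma orbit_ball_double:
  assumes "y \<in> orbit_ball T (2 * m) x" "z \<in> orbit_ball T (2 * m) x"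
  shows "z \<in> orbit_ball T m y"
proof -
  have "orbit_dist T y z \<le> orbit_dist T y x + orbit_dist T x z"
    by (rule orbit.triangle) auto
  with assms show ?thesis
    by (simp add: orbit_ball_def orbit.commute[of y x])
qed

section \<open>From finite disjoint closed coverings to \<mu>-equicontinuity\<close>

lemma mu_equicontinuousI:
  assumes cover: "\<And>m \<epsilon>. m \<ge> 1 \<Longrightarrow> \<epsilon> > 0 \<Longrightarrow> \<exists>\<K>. finite \<K> \<and> disjoint \<K> \<and>
      (\<forall>K\<in>\<K>. closed K \<and> (\<exists>x. K \<subseteq> orbit_ball T m x)) \<and> measure \<mu> (\<Union>\<K>) > 1 - \<epsilon>"
  shows "mu_equicontinuous \<mu> T"
  unfolding mu_equicontinuous_def
proof (intro allI impI)
  fix \<epsilon> :: real assume \<epsilon>: "\<epsilon> > 0"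
  \<comment> \<open>These errors sum to \<open>\<epsilon> / 2\<close>, which leaves room for the
    strict bound on \<open>measure \<mu> M\<close>.\<close>
  define e where "e k = \<epsilon> / 2 * (1 / 2) ^ Suc k" for k
  \<comment> \<open>Scale \<open>k\<close> serves \<open>m = Suc k\<close>; the factor 2 pays for
    the recentring by \<open>orbit_ball_double\<close>.\<close>
  have "\<forall>k. \<exists>\<K>. finite \<K> \<and> disjoint \<K> \<and>
      (\<forall>K\<in>\<K>. closed K \<and> (\<exists>x. K \<subseteq> orbit_ball T (2 * Suc k) x)) \<and> measure \<mu> (\<Union>\<K>) > 1 - e k"
    using \<epsilon> by (intro allI cover) (auto simp: e_def)
  then obtain \<K> where fin: "\<And>k. finite (\<K> k)" and dis: "\<And>k. disjoint (\<K> k)"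
    and cl: "\<And>k K. K \<in> \<K> k \<Longrightarrow> closed K"
    and ball: "\<And>k K. K \<in> \<K> k \<Longrightarrow> \<exists>x. K \<subseteq> orbit_ball T (2 * Suc k) x"
    and meas: "\<And>k. measure \<mu> (\<Union>(\<K> k)) > 1 - e k"
    by metis
  define M where "M = (\<Inter>k. \<Union>(\<K> k))"
  have clU: "closed (\<Union>(\<K> k))" for k
    using fin cl by (intro closed_Union) auto
  have clM: "closed M"
    unfolding M_def using clU by auto
  have compl: "measure \<mu> (- \<Union>(\<K> k)) \<le> e k" for k
    using meas[of k] prob_compl[of "\<Union>(\<K> k)"] clU by (simp add: Compl_eq_Diff_UNIV)
  have e_sums: "e sums (\<epsilon> / 2)"
    unfolding e_def using sums_mult[OF power_half_series, of "\<epsilon> / 2"] by simp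
  have summ: "summable (\<lambda>k. measure \<mu> (- \<Union>(\<K> k)))"
    using compl by (intro summable_comparison_test'[OF sums_summable[OF e_sums], of 0]) simp
  have compl_sets: "- \<Union>(\<K> k) \<in> sets \<mu>" for k
    using clU[of k] sets.compl_sets[of "\<Union>(\<K> k)" \<mu>] by (simp add: Compl_eq_Diff_UNIV)
  have "measure \<mu> (- M) = measure \<mu> (\<Union>k. - \<Union>(\<K> k))"
    by (simp add: M_def)
  also have "\<dots> \<le> (\<Sum>k. measure \<mu> (- \<Union>(\<K> k)))"
    using compl_sets by (intro finite_measure_subadditive_countably summ) auto
  also have "\<dots> \<le> (\<Sum>k. e k)"
    by (intro suminf_le summ compl sums_summable[OF e_sums])
  also have "\<dots> = \<epsilon> / 2"
    using e_sums by (simp add: sums_iff)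
  finally have "measure \<mu> M > 1 - \<epsilon>"
    using \<epsilon> prob_compl[of M] clM by (simp add: Compl_eq_Diff_UNIV)
  moreover have "equicontinuous_on_set T M"
    unfolding equicontinuous_on_set_def
  proof (intro ballI allI impI)
    fix x and m :: nat assume x: "x \<in> M" and "m \<ge> 1"
    then obtain k where k: "m = Suc k"
      by (cases m) auto
    from x obtain K where K: "K \<in> \<K> k" "x \<in> K"
      by (auto simp: M_def)
    \<comment> \<open>The other pieces of this scale form a closed set missing \<open>x\<close>. A
      ball about \<open>x\<close> that avoids it meets \<open>M\<close> only inside
      \<open>K\<close>.\<close>
    define C where "C = \<Union>(\<K> k - {K})"
    have "closed C"
      unfolding C_def using fin cl by (intro closed_Union) auto
    moreover have "x \<notin> C"
      using dis[of k] K by (auto simp: C_def disjoint_def)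
    ultimately obtain r where r: "r > 0" "ball x r \<subseteq> - C"
      using openE[of "- C" x] by auto
    obtain n :: nat where n: "1 / real (Suc n) < r"
      using nat_approx_posE[OF r(1)] .
    have "cball x (1 / real (Suc n)) \<inter> M \<subseteq> orbit_ball T m x"
    proof
      fix y assume y: "y \<in> cball x (1 / real (Suc n)) \<inter> M"
      then have "y \<in> ball x r"
        using n by simp
      with r(2) have "y \<notin> C"
        by blast
      moreover have "y \<in> \<Union>(\<K> k)"
        using y by (auto simp: M_def)
      ultimately have "y \<in> K"
        by (auto simp: C_def)
      with K ball show "y \<in> orbit_ball T m x"
        unfolding k by (meson orbit_ball_double subsetD)
    qed
    then show "\<exists>n\<ge>1. cball x (1 / real n) \<inter> M \<subseteq> orbit_ball T m x"
      by (intro exI[of _ "Suc n"]) simp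
  qed
  moreover have "compact M"
    using compact_Int_closed[OF compact_UNIV clM] by simp
  ultimately show "\<exists>M. compact M \<and> measure \<mu> M > 1 - \<epsilon> \<and> equicontinuous_on_set T M"
    by blast
qed

section \<open>From \<mu>-equicontinuity to separability of the orbit metric\<close>

lemma separable_space_orbit_iff:
  "separable_space (Metric_space.mtopology X (orbit_dist T)) \<longleftrightarrow>
    (\<exists>C. countable C \<and> C \<subseteq> X \<and> (\<forall>x\<in>X. \<forall>m\<ge>1. \<exists>y\<in>C. x \<in> orbit_ball T m y))"
    (is "_ \<longleftrightarrow> (\<exists>C. countable C \<and> C \<subseteq> X \<and> ?dense C)")
proof -
  \<comment> \<open>The carrier is now \<open>X\<close>, because the dense set has to lie in
    \<open>X\<close> itself; the sublocale \<open>orbit\<close> has carrier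
    \<open>UNIV\<close>.\<close>
  interpret X: Metric_space X "orbit_dist T"
    by (rule Metric_space_orbit_dist[OF compact_UNIV])
  have "X.mtopology closure_of C = X \<longleftrightarrow> ?dense C" if C: "C \<subseteq> X" for C
  proof
    assume cl: "X.mtopology closure_of C = X"
    show "?dense C"
    proof (intro ballI allI impI)
      fix x and m :: nat assume "x \<in> X" "m \<ge> 1"
      then have "x \<in> X.mtopology closure_of C" "1 / real m > 0"
        using cl by auto
      then obtain y where "y \<in> C" "orbit_dist T x y < 1 / real m"
        unfolding X.metric_closure_of X.in_mball by blast
      then show "\<exists>y\<in>C. x \<in> orbit_ball T m y"
        by (intro bexI[of _ y]) (simp_all add: orbit_ball_def orbit.commute[of x])
    qed
  next
    assume dense: "?dense C"
    have "\<exists>y\<in>C. y \<in> X.mball x r" if x: "x \<in> X" and r: "r > 0" for x r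
    proof -
      obtain n where n: "1 / real (Suc n) < r"
        using nat_approx_posE[OF r] .
      obtain y where y: "y \<in> C" "x \<in> orbit_ball T (Suc n) y"
        using dense x by force
      then have "orbit_dist T x y < r"
        using n by (simp add: orbit_ball_commute[of x]) (simp add: orbit_ball_def)
      with x y(1) C show ?thesis
        unfolding X.in_mball by blast
    qed
    then show "X.mtopology closure_of C = X"
      unfolding X.metric_closure_of by blast
  qed
  then show ?thesis
    unfolding separable_space_def X.topspace_mtopology by (intro ex_cong1 conj_cong refl) simp
qed

text \<open>The radius supplied by equicontinuity depends on \<open>x\<close> and \<open>m\<close>,
  so finite nets of \<open>M\<close> of every mesh \<open>1 / Suc n\<close> are collected into one
  countable set. A net point close to \<open>x\<close> lies in the orbit ball of \<open>x\<close>,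
  and symmetry exchanges the two.\<close>

lemma equicontinuous_imp_orbit_separable:
  assumes M: "compact M" and eq: "equicontinuous_on_set T M"
  shows "\<exists>C. countable C \<and> C \<subseteq> M \<and> (\<forall>x\<in>M. \<forall>m\<ge>1. \<exists>y\<in>C. x \<in> orbit_ball T m y)"
proof -
  have "\<forall>n. \<exists>F. finite F \<and> F \<subseteq> M \<and> M \<subseteq> (\<Union>y\<in>F. ball y (1 / real (Suc n)))"
    using seq_compact_imp_totally_bounded[OF compact_imp_seq_compact[OF M]] by simp
  then obtain F where F: "\<And>n. finite (F n)" "\<And>n. F n \<subseteq> M"
      "\<And>n. M \<subseteq> (\<Union>y\<in>F n. ball y (1 / real (Suc n)))"
    by metis
  have "\<exists>y\<in>\<Union>(range F). x \<in> orbit_ball T m y" if "x \<in> M" "m \<ge> 1" for x m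
  proof -
    obtain n where n: "n \<ge> 1" "cball x (1 / real n) \<inter> M \<subseteq> orbit_ball T m x"
      using eq \<open>x \<in> M\<close> \<open>m \<ge> 1\<close> unfolding equicontinuous_on_set_def by blast
    obtain y where y: "y \<in> F (n - 1)" "x \<in> ball y (1 / real (Suc (n - 1)))"
      using F(3)[of "n - 1"] \<open>x \<in> M\<close> by blast
    have "y \<in> cball x (1 / real n) \<inter> M"
      using y n(1) F(2) by (auto simp: dist_commute)
    then show ?thesis
      using n(2) y(1) orbit_ball_commute by blast
  qed
  moreover have "countable (\<Union>(range F))"
    using F(1) by (auto intro: countable_finite)
  ultimately show ?thesis
    using F(2) by (intro exI[of _ "\<Union>(range F)"]) blast
qed

text \<open>The choice \<epsilon> = \<open>1 / Suc k\<close> suffices: the sets need not be nested,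
  since their union is at least as large as each of them. Both consequences of \<mu>-equicontinuity
  start from this sequence.\<close>

lemma mu_equicontinuous_sequence:
  assumes "mu_equicontinuous \<mu> T"
  obtains M :: "nat \<Rightarrow> 'a set"
  where "\<And>k. compact (M k)" "\<And>k. equicontinuous_on_set T (M k)"
    "measure \<mu> (\<Union>k. M k) = 1"
proof -
  have "\<forall>k. \<exists>M. compact M \<and> measure \<mu> M > 1 - 1 / real (Suc k) \<and> equicontinuous_on_set T M"
    using assms by (simp add: mu_equicontinuous_def)
  then obtain M where M: "\<And>k. compact (M k)" "\<And>k. measure \<mu> (M k) > 1 - 1 / real (Suc k)"
      "\<And>k. equicontinuous_on_set T (M k)"
    by metis
  have sets: "M k \<in> sets \<mu>" for k
    using M(1) by (simp add: compact_imp_closed)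
  have "(\<lambda>k. 1 - 1 / real (Suc k)) \<longlonglongrightarrow> 1 - 0"
    by (intro tendsto_intros lim_1_over_n[THEN LIMSEQ_Suc])
  moreover have "1 - 1 / real (Suc k) \<le> measure \<mu> (\<Union>k. M k)" for k
  proof -
    have "measure \<mu> (M k) \<le> measure \<mu> (\<Union>k. M k)"
      using sets by (intro finite_measure_mono) auto
    with M(2)[of k] show ?thesis by linarith
  qed
  ultimately have "1 \<le> measure \<mu> (\<Union>k. M k)"
    by (intro LIMSEQ_le_const2) auto
  then show thesis
    using M that[of M] prob_le_1[of "\<Union>k. M k"] by (simp add: antisym)
qed

lemma mu_equicontinuous_imp_separable:
  assumes "mu_equicontinuous \<mu> T"
  shows "\<exists>X'. X' \<in> sets \<mu> \<and> measure \<mu> X' = 1 \<and>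
    separable_space (Metric_space.mtopology X' (orbit_dist T))"
proof -
  obtain M :: "nat \<Rightarrow> 'a set"
    where M: "\<And>k. compact (M k)" "\<And>k. equicontinuous_on_set T (M k)"
      "measure \<mu> (\<Union>k. M k) = 1"
    using mu_equicontinuous_sequence[OF assms] by blast
  have "\<forall>k. \<exists>C. countable C \<and> C \<subseteq> M k \<and> (\<forall>x\<in>M k. \<forall>m\<ge>1. \<exists>y\<in>C. x \<in> orbit_ball T m y)"
    using equicontinuous_imp_orbit_separable M by blast
  then obtain C where C: "\<And>k. countable (C k)" "\<And>k. C k \<subseteq> M k"
      "\<And>k x m. x \<in> M k \<Longrightarrow> m \<ge> 1 \<Longrightarrow> \<exists>y\<in>C k. x \<in> orbit_ball T m y"
    by metis
  have "separable_space (Metric_space.mtopology (\<Union>k. M k) (orbit_dist T))"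
    unfolding separable_space_orbit_iff
    by (rule exI[of _ "\<Union>k. C k"]) (use C in \<open>auto; blast\<close>)
  moreover have "(\<Union>k. M k) \<in> sets \<mu>"
    using M(1) by (intro sets.countable_UN) (auto simp: compact_imp_closed)
  ultimately show ?thesis
    using M(3) by blast
qed

section \<open>From separability of the orbit metric to \<mu>-equicontinuity\<close>

lemma separable_imp_mu_equicontinuous:
  assumes X: "X \<in> sets \<mu>" "measure \<mu> X = 1"
    and sep: "separable_space (Metric_space.mtopology X (orbit_dist T))"
  shows "mu_equicontinuous \<mu> T"
proof (rule mu_equicontinuousI)
  fix m :: nat and \<epsilon> :: real assume m: "m \<ge> 1" and \<epsilon>: "\<epsilon> > 0"
  obtain C where C: "countable C" "\<And>x. x \<in> X \<Longrightarrow> \<exists>y\<in>C. x \<in> orbit_ball T m y"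
    using sep m unfolding separable_space_orbit_iff by blast
  have "X \<noteq> {}"
    using X(2) by auto
  with C(2) have "C \<noteq> {}"
    by blast
  \<comment> \<open>The enumeration may repeat centres, but a repeated ball has distance 0 from its
    earlier copy and gives an empty \<open>K n j\<close> below.\<close>
  define B where "B j = orbit_ball T m (from_nat_into C j)" for j
  have clB: "closed (B j)" for j
    by (simp add: B_def closed_orbit_ball)
  have XB: "X \<subseteq> (\<Union>j. B j)"
    using C(2) range_from_nat_into[OF \<open>C \<noteq> {}\<close> C(1)] by (force simp: B_def)
  \<comment> \<open>Removing the earlier balls outright could destroy closedness. Keeping a gap of
    \<open>1 / Suc n\<close> preserves it, and as \<open>n\<close> grows these sets increase to
    \<open>B j\<close> without the earlier balls.\<close>
  define K where "K n j = B j \<inter> (\<Inter>i\<in>{..<j}. \<Inter>y\<in>B i. {x. 1 / real (Suc n) \<le> dist x y})" for n j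
  have clK: "closed (K n j)" for n j
    unfolding K_def
    by (intro closed_Int closed_INT clB ballI closed_Collect_le continuous_intros)
  have "False" if "i < j" "x \<in> K n i" "x \<in> K n j" for n i j x
  proof -
    have "1 / real (Suc n) \<le> dist x x"
      using that unfolding K_def by blast
    then show False by simp
  qed
  then have disj: "disjoint_family_on (K n) A" for n A
    unfolding disjoint_family_on_def by (metis disjoint_iff linorder_neqE_nat)
  \<comment> \<open>Here \<open>n\<close> controls both the number of pieces and the gap, so one
    increasing sequence of closed sets covers \<open>X\<close> in the limit.\<close>
  define L where "L n = (\<Union>j<n. K n j)" for n
  have clL: "closed (L n)" for n
    unfolding L_def using clK by (intro closed_UN) auto
  have K_mono: "K n j \<subseteq> K n' j" if "n \<le> n'" for n n' j
  proof -
    have "1 / real (Suc n') \<le> 1 / real (Suc n)"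
      using that by (simp add: frac_le)
    then show ?thesis
      unfolding K_def by (blast intro: order_trans)
  qed
  have "incseq L"
    unfolding incseq_def L_def using K_mono by (meson UN_mono lessThan_subset_iff)
  have "X \<subseteq> (\<Union>n. L n)"
  proof
    fix x assume "x \<in> X"
    then have ex: "\<exists>j. x \<in> B j"
      using XB by blast
    define j where "j = (LEAST j. x \<in> B j)"
    have j: "x \<in> B j" "\<And>i. i < j \<Longrightarrow> x \<notin> B i"
      using LeastI_ex[OF ex] not_less_Least unfolding j_def by blast+
    have "open (- (\<Union>i<j. B i))"
      using clB by (intro open_Compl closed_UN) auto
    then obtain r where r: "r > 0" "ball x r \<subseteq> - (\<Union>i<j. B i)"
      using j(2) by (metis (no_types, lifting) ComplI UN_E lessThan_iff openE)
    obtain n where n: "1 / real (Suc n) < r"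
      using nat_approx_posE[OF r(1)] .
    have "x \<in> K n j"
    proof -
      have "1 / real (Suc n) \<le> dist x y" if "i < j" "y \<in> B i" for i y
      proof -
        have "y \<notin> ball x r"
          using r(2) that by blast
        with n show ?thesis by simp
      qed
      with j(1) show ?thesis
        by (auto simp: K_def)
    qed
    \<comment> \<open>The maximum meets both demands: the gap is small enough and the index
      \<open>j\<close> is below the bound.\<close>
    then have "x \<in> K (max n (Suc j)) j"
      using K_mono[of n "max n (Suc j)" j] by auto
    then show "x \<in> (\<Union>n. L n)"
      by (force simp: L_def)
  qed
  then have "measure \<mu> X \<le> measure \<mu> (\<Union>n. L n)"
    using clL by (intro finite_measure_mono) auto
  with X(2) have "measure \<mu> (\<Union>n. L n) > 1 - \<epsilon>"
    using \<epsilon> by simp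
  moreover have "(\<lambda>n. measure \<mu> (L n)) \<longlonglongrightarrow> measure \<mu> (\<Union>n. L n)"
    using clL \<open>incseq L\<close> by (intro finite_Lim_measure_incseq) auto
  ultimately have "eventually (\<lambda>n. measure \<mu> (L n) > 1 - \<epsilon>) sequentially"
    by (intro order_tendstoD(1))
  then obtain n where n: "measure \<mu> (L n) > 1 - \<epsilon>"
    by (auto simp: eventually_sequentially)
  show "\<exists>\<K>. finite \<K> \<and> disjoint \<K> \<and>
      (\<forall>K\<in>\<K>. closed K \<and> (\<exists>x. K \<subseteq> orbit_ball T m x)) \<and> measure \<mu> (\<Union>\<K>) > 1 - \<epsilon>"
  proof (intro exI[of _ "K n ` {..<n}"] conjI ballI)
    show "disjoint (K n ` {..<n})"
      by (rule disjoint_family_on_disjoint_image[OF disj])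
    show "measure \<mu> (\<Union>(K n ` {..<n})) > 1 - \<epsilon>"
      using n by (simp add: L_def)
  qed (auto simp: clK, auto simp: K_def B_def)
qed

section \<open>From equicontinuity points to \<mu>-equicontinuity under the Vitali property\<close>

text \<open>At almost every centre the orbit ball fills most of every small enough ball; on
  \<open>A N\<close> the index from which this holds is uniform. A Vitali family centred in
  \<open>A N\<close> misses at most \<delta> of \<open>A N\<close>, and passing to orbit balls costs
  at most a fraction \<delta> of each of its balls.\<close>

lemma vitali_imp_mu_equicontinuous:
  assumes vit: "vitali \<mu>" and ae: "AE x in \<mu>. mu_equicontinuity_point \<mu> T x"
  shows "mu_equicontinuous \<mu> T"
proof (rule mu_equicontinuousI)
  fix m :: nat and \<epsilon> :: real assume m: "m \<ge> 1" and \<epsilon>: "\<epsilon> > 0"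
  \<comment> \<open>The final estimate needs
    \<open>(1 - \<delta>) * (1 - 2 * \<delta>) > 1 - \<epsilon>\<close>, which follows from
    \<open>3 * \<delta> < \<epsilon>\<close>; the cap by 1 keeps \<open>1 - \<delta>\<close>
    positive.\<close>
  define \<delta> where "\<delta> = min \<epsilon> 1 / 4"
  have \<delta>: "\<delta> > 0" "\<delta> \<le> 1 / 4" "\<delta> \<le> \<epsilon> / 4"
    using \<epsilon> by (auto simp: \<delta>_def)
  define K where "K n x = orbit_ball T m x \<inter> cball x (1 / real n)" for n x
  have clK: "closed (K n x)" for n x
    by (simp add: K_def closed_orbit_ball closed_Int)
  \<comment> \<open>The density bound is multiplied out, so that balls of measure zero satisfy it
    trivially. Vitali requires this set to be Borel, hence the measurability facts that
    follow.\<close>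
  define A where "A N = {x. \<forall>n\<ge>N. (1 - \<delta>) * measure \<mu> (cball x (1 / real n)) \<le> measure \<mu> (K n x)}"
    for N
  have [measurable]: "(\<lambda>x. measure \<mu> (K n x)) \<in> borel_measurable borel" for n
  proof (rule borel_measurable_measure_section)
    fix y
    have "{x. y \<in> K n x} = K n y"
      by (auto simp: K_def dist_commute orbit_ball_commute)
    then show "closed {x. y \<in> K n x}"
      by (simp add: clK)
  qed (simp add: clK)
  have [measurable]: "(\<lambda>x. measure \<mu> (cball x (1 / real n))) \<in> borel_measurable borel" for n
  proof (rule borel_measurable_measure_section)
    fix y
    have "{x. y \<in> cball x (1 / real n)} = cball y (1 / real n)"
      by (auto simp: dist_commute)
    then show "closed {x. y \<in> cball x (1 / real n)}"
      by simp
  qed simp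
  have A [measurable]: "A N \<in> sets borel" for N
  proof -
    have "{x\<in>space borel. \<forall>n\<ge>N. (1 - \<delta>) * measure \<mu> (cball x (1 / real n)) \<le> measure \<mu> (K n x)}
        \<in> sets borel"
      by measurable
    then show ?thesis by (simp add: A_def)
  qed
  have "AE x in \<mu>. x \<in> (\<Union>N. A N)"
    using ae
  proof eventually_elim
    case (elim x)
    have "(\<lambda>n. measure \<mu> (K n x) / measure \<mu> (cball x (1 / real n))) \<longlonglongrightarrow> 1"
      using elim m by (simp add: mu_equicontinuity_point_def K_def)
    then have "eventually (\<lambda>n. 1 - \<delta> < measure \<mu> (K n x) / measure \<mu> (cball x (1 / real n)))
        sequentially"
      by (rule order_tendstoD) (use \<delta> in simp)
    then obtain N where N: "\<And>n. n \<ge> N \<Longrightarrow>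
        1 - \<delta> < measure \<mu> (K n x) / measure \<mu> (cball x (1 / real n))"
      by (auto simp: eventually_sequentially)
    have "(1 - \<delta>) * measure \<mu> (cball x (1 / real n)) \<le> measure \<mu> (K n x)" if "n \<ge> N" for n
    proof (cases "measure \<mu> (cball x (1 / real n)) = 0")
      case False
      then have "measure \<mu> (cball x (1 / real n)) > 0"
        by (simp add: zero_less_measure_iff)
      with N[OF that] show ?thesis
        by (simp add: pos_less_divide_eq)
    qed simp
    then show ?case
      by (auto simp: A_def)
  qed
  then have "measure \<mu> (\<Union>N. A N) = 1"
    using A by (subst prob_eq_1) (auto simp: sets_eq)
  moreover have "(\<lambda>N. measure \<mu> (A N)) \<longlonglongrightarrow> measure \<mu> (\<Union>N. A N)"
    using A by (intro finite_Lim_measure_incseq) (auto simp: sets_eq incseq_def A_def)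
  ultimately have "eventually (\<lambda>N. measure \<mu> (A N) > 1 - \<delta>) sequentially"
    using \<delta> by (intro order_tendstoD(1)) auto
  then obtain N where N: "N \<ge> 1" "measure \<mu> (A N) > 1 - \<delta>"
    unfolding eventually_sequentially by (meson linorder_linear order_trans)
  \<comment> \<open>Since all indices \<open>n x\<close> are at least \<open>N\<close>, the bound
    defining \<open>A N\<close> applies to every chosen ball.\<close>
  obtain F n where F: "finite F" "F \<subseteq> A N" "\<forall>x\<in>F. n x \<ge> N"
      and disj: "disjoint_family_on (\<lambda>x. cball x (1 / real (n x))) F"
      and rest: "measure \<mu> (A N - (\<Union>x\<in>F. cball x (1 / real (n x)))) \<le> \<delta>"
    using vit[unfolded vitali_def, rule_format, OF A[of N] N(1) \<delta>(1)] by blast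
  define U where "U = (\<Union>x\<in>F. cball x (1 / real (n x)))"
  have "closed U"
    unfolding U_def using F(1) by (intro closed_UN) auto
  have disjK: "disjoint_family_on (\<lambda>x. K (n x) x) F"
    using disj unfolding disjoint_family_on_def K_def by blast
  have "measure \<mu> (A N) \<le> measure \<mu> ((A N - U) \<union> U)"
    using A \<open>closed U\<close> by (intro finite_measure_mono) (auto simp: sets_eq)
  also have "\<dots> \<le> measure \<mu> (A N - U) + measure \<mu> U"
    using A \<open>closed U\<close> by (intro measure_Un_le) (auto simp: sets_eq)
  finally have U: "measure \<mu> U \<ge> 1 - 2 * \<delta>"
    using N(2) rest by (simp add: U_def)
  have "1 - \<epsilon> < 1 - 3 * \<delta> + 2 * \<delta>\<^sup>2"
    using \<delta> zero_le_power2[of \<delta>] by linarith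
  also have "\<dots> = (1 - \<delta>) * (1 - 2 * \<delta>)"
    by (simp add: algebra_simps power2_eq_square)
  also have "\<dots> \<le> (1 - \<delta>) * measure \<mu> U"
    using U \<delta> by (intro mult_left_mono) auto
  also have "measure \<mu> U = (\<Sum>x\<in>F. measure \<mu> (cball x (1 / real (n x))))"
    unfolding U_def using F(1) disj by (intro finite_measure_finite_Union) auto
  also have "(1 - \<delta>) * \<dots> \<le> (\<Sum>x\<in>F. measure \<mu> (K (n x) x))"
    unfolding sum_distrib_left using F(2,3) by (intro sum_mono) (auto simp: A_def)
  also have "\<dots> = measure \<mu> (\<Union>x\<in>F. K (n x) x)"
    using F(1) disjK clK by (intro finite_measure_finite_Union[symmetric]) auto
  finally have "measure \<mu> (\<Union>x\<in>F. K (n x) x) > 1 - \<epsilon>" .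
  with F(1) show "\<exists>\<K>. finite \<K> \<and> disjoint \<K> \<and>
      (\<forall>K\<in>\<K>. closed K \<and> (\<exists>x. K \<subseteq> orbit_ball T m x)) \<and> measure \<mu> (\<Union>\<K>) > 1 - \<epsilon>"
    using clK disjoint_family_on_disjoint_image[OF disjK]
    by (intro exI[of _ "(\<lambda>x. K (n x) x) ` F"]) (auto, auto simp: K_def)
qed

section \<open>From \<mu>-equicontinuity to equicontinuity points under Lebesgue density\<close>

text \<open>Close to \<open>x\<close>, equicontinuity forces \<open>M\<close> into the orbit ball of
  \<open>x\<close>, which thus inherits density 1 from \<open>M\<close>.\<close>

lemma equicontinuous_density_point:
  assumes M: "compact M" "equicontinuous_on_set T M" "x \<in> M"
    and lim: "(\<lambda>n. measure \<mu> (M \<inter> cball x (1 / real n)) / measure \<mu> (cball x (1 / real n)))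
      \<longlonglongrightarrow> 1"
  shows "mu_equicontinuity_point \<mu> T x"
  unfolding mu_equicontinuity_point_def
proof (intro allI impI)
  fix m :: nat assume "m \<ge> 1"
  then obtain k where k: "k \<ge> 1" "cball x (1 / real k) \<inter> M \<subseteq> orbit_ball T m x"
    using M(2,3) unfolding equicontinuous_on_set_def by blast
  show "(\<lambda>n. measure \<mu> (orbit_ball T m x \<inter> cball x (1 / real n)) / measure \<mu> (cball x (1 / real n)))
      \<longlonglongrightarrow> 1"
  proof (rule tendsto_sandwich[OF _ _ lim tendsto_const])
    show "eventually (\<lambda>n. measure \<mu> (M \<inter> cball x (1 / real n)) / measure \<mu> (cball x (1 / real n))
        \<le> measure \<mu> (orbit_ball T m x \<inter> cball x (1 / real n)) / measure \<mu> (cball x (1 / real n)))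
        sequentially"
    proof (rule eventually_sequentiallyI[of k])
      fix n assume "n \<ge> k"
      with k(1) have "cball x (1 / real n) \<subseteq> cball x (1 / real k)"
        by (intro subset_cball) (simp add: frac_le)
      with k(2) have "M \<inter> cball x (1 / real n) \<subseteq> orbit_ball T m x \<inter> cball x (1 / real n)"
        by blast
      then show "measure \<mu> (M \<inter> cball x (1 / real n)) / measure \<mu> (cball x (1 / real n))
          \<le> measure \<mu> (orbit_ball T m x \<inter> cball x (1 / real n)) / measure \<mu> (cball x (1 / real n))"
        by (intro divide_right_mono finite_measure_mono) (auto simp: closed_orbit_ball closed_Int)
    qed
    \<comment> \<open>The upper bound 1 also covers balls of measure zero, where the quotient is 0
      by convention.\<close>
    have "measure \<mu> (orbit_ball T m x \<inter> cball x (1 / real n)) \<le> measure \<mu> (cball x (1 / real n))" for n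
      by (intro finite_measure_mono) auto
    then show "eventually (\<lambda>n. measure \<mu> (orbit_ball T m x \<inter> cball x (1 / real n)) /
        measure \<mu> (cball x (1 / real n)) \<le> 1) sequentially"
      by (auto simp: divide_le_eq_1 zero_less_measure_iff intro!: always_eventually)
  qed
qed

text \<open>The density theorem is applied to each of countably many compact sets; their exceptional
  sets and the complement of their union are together null.\<close>

lemma density_imp_mu_equicontinuity_points:
  assumes dens: "lebesgue_density \<mu>" and eq: "mu_equicontinuous \<mu> T"
  shows "AE x in \<mu>. mu_equicontinuity_point \<mu> T x"
proof -
  obtain M :: "nat \<Rightarrow> 'a set"
    where M: "\<And>k. compact (M k)" "\<And>k. equicontinuous_on_set T (M k)"
      "measure \<mu> (\<Union>k. M k) = 1"
    using mu_equicontinuous_sequence[OF eq] by blast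
  have "AE x in \<mu>. x \<in> M k \<longrightarrow> (\<lambda>n. measure \<mu> (M k \<inter> cball x (1 / real n)) /
      measure \<mu> (cball x (1 / real n))) \<longlonglongrightarrow> 1" for k
    using dens M(1) by (simp add: lebesgue_density_def compact_imp_closed)
  then have "AE x in \<mu>. \<forall>k. x \<in> M k \<longrightarrow> (\<lambda>n. measure \<mu> (M k \<inter> cball x (1 / real n)) /
      measure \<mu> (cball x (1 / real n))) \<longlonglongrightarrow> 1"
    by (simp add: AE_all_countable)
  with AE_prob_1[OF M(3)] show ?thesis
    by eventually_elim (use M equicontinuous_density_point in blast)
qed

end

theorem theorem9:
  fixes T :: "'a::metric_space \<Rightarrow> 'a" and \<mu> :: "'a measure"
  assumes "compact (UNIV :: 'a set)"
    and "continuous_on UNIV T"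
    and "prob_space \<mu>"
    and "sets \<mu> = sets borel"
  shows "(mu_equicontinuous \<mu> T \<longleftrightarrow>
            (\<exists>X'. X' \<in> sets \<mu> \<and> measure \<mu> X' = 1 \<and>
               separable_space (Metric_space.mtopology X' (orbit_dist T))))
       \<and> (vitali \<mu> \<longrightarrow> (AE x in \<mu>. mu_equicontinuity_point \<mu> T x) \<longrightarrow> mu_equicontinuous \<mu> T)
       \<and> (lebesgue_density \<mu> \<longrightarrow> mu_equicontinuous \<mu> T \<longrightarrow> (AE x in \<mu>. mu_equicontinuity_point \<mu> T x))"
proof -
  interpret prob_tds \<mu> T
    using assms by (intro prob_tds.intro prob_tds_axioms.intro)
  show ?thesis
    using mu_equicontinuous_imp_separable separable_imp_mu_equicontinuous
      vitali_imp_mu_equicontinuous density_imp_mu_equicontinuity_points by blast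
qed

end
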